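(* For all $k,M\in\mathbb{N}$, $$G_{k,1,M}(x)\in\mathbb{N}_0[[x]].$$ Equivalently, for all $a,b,M\in\mathbb{N}$ with $b\mid a$, one has $g_{a,b,a+b}(1,M;q)\in\mathbb{N}_0[[q]]$.
   Context: $\mathbb{N}$ is the set of positive integers and $\mathbb{N}_0=\mathbb{N}\cup\{0\}$. Notation: $(z;q)_n=\prod_{i=0}^{n-1}(1-zq^i)$. For $a,b,m,N,M\in\mathbb{N}$, $$g_{a,b,m}(N,M;q):=\frac{(-q^m;q^m)_{N+M-1}}{(-q^a;q^m)_N\,(q^b;q^m)_M},$$ and for $k,N,M\in\mathbb{N}$, $$G_{k,N,M}(x):=\frac{(-x^{k+1};x^{k+1})_{N+M-1}}{(-x^{k};x^{k+1})_N\,(x;x^{k+1})_M},$$ both expanded as formal power series. When $a=kb$ one has $G_{k,N,M}(q^b)=g_{a,b,a+b}(N,M;q)$. $\mathbb{N}_0[[x]]$ is the set of power series with non-negative integer coefficients. *)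

theory Defs
  imports "HOL-Computational_Algebra.Formal_Power_Series"
begin

text \<open>The finite q-Pochhammer symbol \<open>(z; q)\<^sub>n\<close>.\<close>
definition qpoch :: "'a::comm_ring_1 \<Rightarrow> 'a \<Rightarrow> nat \<Rightarrow> 'a" where
  "qpoch z q n = (\<Prod>i<n. 1 - z * q ^ i)"

text \<open>The two quotients below are expanded in \<^typ>\<open>rat fps\<close>, because division of power series
  needs a field of coefficients. For positive \<open>a\<close>, \<open>b\<close>, \<open>k\<close> the denominators have constant
  coefficient 1, so the division is exact (see \<open>gser_mult_denom\<close> and \<open>Gser_mult_denom\<close>).
  The truncated subtraction in \<open>N + M - 1\<close> is harmless for positive \<open>N\<close>, \<open>M\<close>.\<close>
definition gser :: "nat \<Rightarrow> nat \<Rightarrow> nat \<Rightarrow> nat \<Rightarrow> nat \<Rightarrow> rat fps" where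
  "gser a b m N M =
     qpoch (- (fps_X ^ m)) (fps_X ^ m) (N + M - 1) /
     (qpoch (- (fps_X ^ a)) (fps_X ^ m) N * qpoch (fps_X ^ b) (fps_X ^ m) M)"

definition Gser :: "nat \<Rightarrow> nat \<Rightarrow> nat \<Rightarrow> rat fps" where
  "Gser k N M =
     qpoch (- (fps_X ^ (k + 1))) (fps_X ^ (k + 1)) (N + M - 1) /
     (qpoch (- (fps_X ^ k)) (fps_X ^ (k + 1)) N * qpoch fps_X (fps_X ^ (k + 1)) M)"

text \<open>\<open>\<nat>\<^sub>0[[x]]\<close>; in the library, \<open>\<nat>\<close> contains 0.\<close>
definition nonneg_int_fps :: "rat fps set" where
  "nonneg_int_fps = {f. \<forall>n. fps_nth f n \<in> \<nat>}"

lemma qpoch_nth_0: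
  fixes z q :: "'a::comm_ring_1 fps"
  assumes "fps_nth z 0 = 0"
  shows "fps_nth (qpoch z q n) 0 = 1"
  using assms by (induction n) (simp_all add: qpoch_def)

lemma gser_mult_denom:
  assumes "a > 0" "b > 0"
  shows "gser a b m N M * (qpoch (- (fps_X ^ a)) (fps_X ^ m) N * qpoch (fps_X ^ b) (fps_X ^ m) M)
           = qpoch (- (fps_X ^ m)) (fps_X ^ m) (N + M - 1)"
  using assms
  by (simp add: gser_def fps_divide_unit qpoch_nth_0 mult.assoc inverse_mult_eq_1)

lemma Gser_mult_denom:
  assumes "k > 0"
  shows "Gser k N M *
           (qpoch (- (fps_X ^ k)) (fps_X ^ (k + 1)) N * qpoch fps_X (fps_X ^ (k + 1)) M)
           = qpoch (- (fps_X ^ (k + 1))) (fps_X ^ (k + 1)) (N + M - 1)"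
  using assms gser_mult_denom[of k 1 "k + 1" N M] by (simp add: Gser_def gser_def)

end

theory Submission
  imports Defs
begin

text \<open>
  Increasing \<open>M\<close> by one multiplies the quotient by
  \<open>(1 + q ^ (m * (N + M))) / (1 - q ^ (b + m * M))\<close>, which has non-negative coefficients, so only
  \<open>M = 1\<close> needs an argument. For \<open>N = M = 1\<close> and \<open>m = a + b\<close> the quotient is
  \<open>1 / (1 - q ^ b) - 1 + 1 / (1 + q ^ a)\<close>; when \<open>b dvd a\<close>, every coefficient \<open>-1\<close> of the last
  term is compensated by a coefficient \<open>1\<close> of the first.
\<close>

lemma nonneg_int_fps_mult:
  assumes "f \<in> nonneg_int_fps" "g \<in> nonneg_int_fps"
  shows "f * g \<in> nonneg_int_fps"
proof -
  \<comment> \<open>Leaving \<open>A\<close>, \<open>h\<close> and \<open>l\<close> arbitrary lets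
    the induction run over the index set while the indices \<open>i\<close> and \<open>n - i\<close>
    of the Cauchy product stay untouched.\<close>
  have "(\<Sum>i\<in>A. fps_nth f (h i) * fps_nth g (l i)) \<in> \<nat>" for A :: "nat set" and h l
    using assms by (induction A rule: infinite_finite_induct) (auto simp: nonneg_int_fps_def)
  then show ?thesis
    by (simp add: nonneg_int_fps_def fps_mult_nth)
qed

lemma one_plus_fps_X_power_nonneg_int: "1 + fps_X ^ n \<in> nonneg_int_fps"
  by (auto simp: nonneg_int_fps_def fps_X_power_nth)

text \<open>Geometric series; the constant \<open>c\<close> covers both signs, \<open>c = 1\<close>
  and \<open>c = -1\<close>.\<close>

lemma inverse_one_minus_const_fps_X_power:
  fixes c :: "'a::field"
  assumes "m > 0"
  shows "inverse (1 - fps_const c * fps_X ^ m) =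
    Abs_fps (\<lambda>n. if m dvd n then c ^ (n div m) else 0)" (is "_ = ?G")
proof -
  \<comment> \<open>For \<open>n < m\<close> only \<open>n = 0\<close> is divisible by
    \<open>m\<close>. For \<open>n = m + l\<close> the coefficient at \<open>n\<close> is cancelled
    by \<open>c\<close> times the one at \<open>l\<close>.\<close>
  have "fps_nth (?G * (1 - fps_const c * fps_X ^ m)) n = fps_nth 1 n" for n
  proof (cases "n < m")
    case True
    then show ?thesis
      using assms by (auto simp: algebra_simps fps_X_power_mult_nth dest: dvd_imp_le)
  next
    case False
    then obtain l where "n = m + l"
      using le_Suc_ex not_less by blast
    then show ?thesis
      using assms by (simp add: algebra_simps fps_X_power_mult_nth)
  qed
  then have "?G * (1 - fps_const c * fps_X ^ m) = 1"
    by (simp add: fps_eq_iff)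
  then show ?thesis
    by (metis fps_inverse_unique mult.commute)
qed

lemma inverse_one_minus_fps_X_power:
  assumes "m > 0"
  shows "inverse (1 - fps_X ^ m :: 'a::field fps) = Abs_fps (\<lambda>n. if m dvd n then 1 else 0)"
  using inverse_one_minus_const_fps_X_power[OF assms, of "1::'a"] by (simp cong: if_cong)

lemma inverse_one_plus_fps_X_power:
  assumes "m > 0"
  shows "inverse (1 + fps_X ^ m :: 'a::field fps) =
    Abs_fps (\<lambda>n. if m dvd n then (-1) ^ (n div m) else 0)"
  using inverse_one_minus_const_fps_X_power[OF assms, of "-1::'a"]
  by (simp flip: fps_const_neg)

lemma gser_Suc:
  assumes "a > 0" "b > 0" "N > 0"
  shows "gser a b m N (Suc M) =
    gser a b m N M * ((1 + fps_X ^ (m * (N + M))) * inverse (1 - fps_X ^ (b + m * M)))"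
proof -
  have "qpoch (- (fps_X ^ m)) (fps_X ^ m) (N + Suc M - 1) =
      qpoch (- (fps_X ^ m)) (fps_X ^ m) (N + M - 1) * (1 + fps_X ^ (m * (N + M)) :: rat fps)"
    \<comment> \<open>Positivity of \<open>N\<close> makes \<open>N + Suc M - 1\<close> the
      successor of \<open>N + M - 1\<close>, so exactly one factor is added, the one of index
      \<open>N + M - 1\<close>.\<close>
    using assms by (cases N) (simp_all add: qpoch_def power_add power_mult)
  moreover have "qpoch (fps_X ^ b) (fps_X ^ m) (Suc M) =
      qpoch (fps_X ^ b) (fps_X ^ m) M * (1 - fps_X ^ (b + m * M) :: rat fps)"
    by (simp add: qpoch_def power_add power_mult)
  ultimately show ?thesis
    using assms
    by (simp add: gser_def fps_divide_unit qpoch_nth_0 fps_inverse_mult mult_ac)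
qed

lemma gser_Suc_nonneg_int:
  assumes "a > 0" "b > 0" "N > 0" "gser a b m N M \<in> nonneg_int_fps"
  shows "gser a b m N (Suc M) \<in> nonneg_int_fps"
proof -
  have "inverse (1 - fps_X ^ (b + m * M)) \<in> nonneg_int_fps"
    using assms by (simp add: inverse_one_minus_fps_X_power nonneg_int_fps_def)
  with assms show ?thesis
    by (simp add: gser_Suc nonneg_int_fps_mult one_plus_fps_X_power_nonneg_int)
qed

lemma gser_1_1:
  assumes "a > 0" "b > 0"
  shows "gser a b (a + b) 1 1 = inverse (1 - fps_X ^ b) - 1 + inverse (1 + fps_X ^ a)"
proof -
  define u v :: "rat fps" where "u = 1 + fps_X ^ a" and "v = 1 - fps_X ^ b"
  have u: "u * inverse u = 1" and v: "v * inverse v = 1"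
    using assms by (simp_all add: u_def v_def inverse_mult_eq_1')
  have "gser a b (a + b) 1 1 = (1 + fps_X ^ (a + b)) * (inverse u * inverse v)"
    using assms by (simp add: gser_def qpoch_def u_def v_def fps_divide_unit fps_inverse_mult)
  \<comment> \<open>This form of the numerator splits into partial fractions on division by
    \<open>u * v\<close>.\<close>
  also have "1 + fps_X ^ (a + b) = u + v - u * v"
    by (simp add: u_def v_def power_add algebra_simps)
  also have "(u + v - u * v) * (inverse u * inverse v) =
      (u * inverse u) * inverse v - (u * inverse u) * (v * inverse v) + (v * inverse v) * inverse u"
    by (simp add: algebra_simps)
  also have "\<dots> = inverse v - 1 + inverse u"
    by (simp add: u v)
  finally show ?thesis
    by (simp add: u_def v_def)
qed

lemma gser_1_1_nonneg_int:
  assumes "a > 0" "b > 0" "b dvd a"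
  shows "gser a b (a + b) 1 1 \<in> nonneg_int_fps"
proof -
  have "fps_nth (gser a b (a + b) 1 1) n \<in> \<nat>" for n
  proof (cases "a dvd n")
    case True
    then have "b dvd n"
      using assms dvd_trans by blast
    with True assms show ?thesis
      \<comment> \<open>The coefficient is 0 for odd \<open>n div a\<close>. For even
        \<open>n div a\<close> it is 2, or 1 at \<open>n = 0\<close>, where the summand
        \<open>- 1\<close> counts.\<close>
      by (cases "even (n div a)")
        (auto simp: gser_1_1[simplified] inverse_one_minus_fps_X_power inverse_one_plus_fps_X_power)
  next
    case False
    \<comment> \<open>Away from \<open>n = 0\<close> the summand \<open>- 1\<close> is absent, so
      only the coefficient 0 or 1 of \<open>inverse (1 - fps_X ^ b)\<close> remains.\<close>
    then have "n > 0"
      by (cases n) auto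
    with False assms show ?thesis
      by (simp add: gser_1_1[simplified] inverse_one_minus_fps_X_power inverse_one_plus_fps_X_power)
  qed
  then show ?thesis
    by (simp add: nonneg_int_fps_def)
qed

lemma gser_1_nonneg_int:
  assumes "a > 0" "b > 0" "M > 0" "b dvd a"
  shows "gser a b (a + b) 1 M \<in> nonneg_int_fps"
proof -
  have "Suc 0 \<le> M"
    using assms by simp
  then show ?thesis
  proof (induction M rule: dec_induct)
    case base
    then show ?case
      using assms gser_1_1_nonneg_int by simp
  next
    case (step M)
    then show ?case
      using assms gser_Suc_nonneg_int by simp
  qed
qed

text \<open>Since 1 divides every \<open>k\<close>, this makes the first half of the theorem the
  case \<open>a = k\<close>, \<open>b = 1\<close> of the second.\<close>

lemma Gser_eq_gser: "Gser k N M = gser k 1 (k + 1) N M"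
  by (simp add: Gser_def gser_def)

theorem theorem3p1:
  shows "(\<forall>k M. k > 0 \<longrightarrow> M > 0 \<longrightarrow> Gser k 1 M \<in> nonneg_int_fps) \<and>
         (\<forall>a b M. a > 0 \<longrightarrow> b > 0 \<longrightarrow> M > 0 \<longrightarrow> b dvd a \<longrightarrow>
            gser a b (a + b) 1 M \<in> nonneg_int_fps)"
  using gser_1_nonneg_int gser_1_nonneg_int[of _ 1] by (simp add: Gser_eq_gser)

end
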